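(* If $1\le n\le 6$ and $k\ge 1$ are integers, then every cyclic snake $kC_{4n}$ is graceful.
   Context: For a graph $G=(V,E)$ with $m$ edges, a map $f:V\to\{0,1,\dots,m\}$ is a graceful labelling if $f$ is injective and the induced edge labelling $g(uv)=|f(u)-f(v)|$ is a bijection from $E$ onto $\{1,2,\dots,m\}$; $G$ is graceful if it has a graceful labelling. $kC_r$ denotes any connected graph with exactly $k$ blocks, each block a cycle $C_r$ of length $r$, whose block-cutpoint graph is a path (so the blocks can be listed $B_1,\dots,B_k$ with $B_i$ and $B_{i+1}$ sharing exactly one vertex, which is the $i$-th cut vertex, and the $k-1$ cut vertices are distinct). *)

theory Defs
  imports Main
begin

datatype 'a graph = Graph (verts: "'a set") (edges: "'a set set")

definition simple_graph :: "'a graph \<Rightarrow> bool" where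
  "simple_graph G \<longleftrightarrow>
     finite (verts G) \<and> (\<forall>e\<in>edges G. e \<subseteq> verts G \<and> card e = 2)"

definition subgraph :: "'a graph \<Rightarrow> 'a graph \<Rightarrow> bool" where
  "subgraph H G \<longleftrightarrow> simple_graph H \<and> verts H \<subseteq> verts G \<and> edges H \<subseteq> edges G"

definition adj :: "'a graph \<Rightarrow> ('a \<times> 'a) set" where
  "adj G = {(u, v). {u, v} \<in> edges G}"

definition connected_graph :: "'a graph \<Rightarrow> bool" where
  "connected_graph G \<longleftrightarrow>
     verts G \<noteq> {} \<and> (\<forall>u\<in>verts G. \<forall>v\<in>verts G. (u, v) \<in> (adj G)\<^sup>*)"

definition delete_vertex :: "'a graph \<Rightarrow> 'a \<Rightarrow> 'a graph" where
  "delete_vertex G v = Graph (verts G - {v}) {e \<in> edges G. v \<notin> e}"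

definition cut_vertex :: "'a graph \<Rightarrow> 'a \<Rightarrow> bool" where
  "cut_vertex G v \<longleftrightarrow> v \<in> verts G \<and>
     (\<exists>u\<in>verts G - {v}. \<exists>w\<in>verts G - {v}.
        (u, w) \<in> (adj G)\<^sup>* \<and> (u, w) \<notin> (adj (delete_vertex G v))\<^sup>*)"

definition nonseparable :: "'a graph \<Rightarrow> bool" where
  "nonseparable H \<longleftrightarrow> connected_graph H \<and> (\<forall>v. \<not> cut_vertex H v)"

text \<open>
  A block is a maximal connected subgraph that has no cut vertex of its own
  (it may well contain cut vertices of the ambient graph).
\<close>

definition blocks :: "'a graph \<Rightarrow> 'a graph set" where
  "blocks G = {B. subgraph B G \<and> nonseparable B \<and>
     (\<forall>H. subgraph H G \<and> nonseparable H \<and> subgraph B H \<longrightarrow> H = B)}"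

definition block_cutpoint_graph :: "'a graph \<Rightarrow> ('a graph + 'a) graph" where
  "block_cutpoint_graph G =
     Graph (Inl ` blocks G \<union> Inr ` {v. cut_vertex G v})
           {{Inl B, Inr v} | B v. B \<in> blocks G \<and> cut_vertex G v \<and> v \<in> verts B}"

definition isomorphic :: "'a graph \<Rightarrow> 'b graph \<Rightarrow> bool" where
  "isomorphic G H \<longleftrightarrow>
     (\<exists>\<phi>. bij_betw \<phi> (verts G) (verts H) \<and> edges H = (\<lambda>e. \<phi> ` e) ` edges G)"

definition standard_cycle :: "nat \<Rightarrow> nat graph" where
  "standard_cycle r = Graph {..<r} {{i, Suc i mod r} | i. i < r}"

definition is_cycle :: "nat \<Rightarrow> 'a graph \<Rightarrow> bool" where
  "is_cycle r G \<longleftrightarrow> r \<ge> 3 \<and> isomorphic (standard_cycle r) G"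

definition standard_path :: "nat \<Rightarrow> nat graph" where
  "standard_path p = Graph {..<p} {{i, Suc i} | i. Suc i < p}"

text \<open>
  The one-vertex graph counts as a path: it is the block-cutpoint graph of a single cycle.
\<close>

definition is_path :: "'a graph \<Rightarrow> bool" where
  "is_path G \<longleftrightarrow> (\<exists>p\<ge>1. isomorphic (standard_path p) G)"

text \<open>
  \<open>cyclic_snake k r G\<close> says that \<open>G\<close> is one of the graphs denoted \<open>kC\<^sub>r\<close>;
  for given \<open>k\<close> and \<open>r\<close> there are in general several of them up to isomorphism.
\<close>

definition cyclic_snake :: "nat \<Rightarrow> nat \<Rightarrow> 'a graph \<Rightarrow> bool" where
  "cyclic_snake k r G \<longleftrightarrow>
     simple_graph G \<and> connected_graph G \<and>
     card (blocks G) = k \<and> (\<forall>B\<in>blocks G. is_cycle r B) \<and>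
     is_path (block_cutpoint_graph G)"

text \<open>
  The induced edge labelling \<open>g\<close> is uniquely determined on the edges by \<open>f\<close>.
\<close>

definition graceful_labelling :: "'a graph \<Rightarrow> ('a \<Rightarrow> nat) \<Rightarrow> bool" where
  "graceful_labelling G f \<longleftrightarrow>
     f ` verts G \<subseteq> {0..card (edges G)} \<and> inj_on f (verts G) \<and>
     (\<exists>g :: 'a set \<Rightarrow> nat.
        (\<forall>u v. {u, v} \<in> edges G \<longrightarrow> int (g {u, v}) = \<bar>int (f u) - int (f v)\<bar>) \<and>
        bij_betw g (edges G) {1..card (edges G)})"

definition graceful :: "'a graph \<Rightarrow> bool" where
  "graceful G \<longleftrightarrow> (\<exists>f. graceful_labelling G f)"

end

theory Submission
  imports Defs
begin

text \<open>
  The blocks of a snake can be listed as \<open>B 0\<close>, ..., \<open>B (K - 1)\<close> so that consecutive blocks share exactly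
  one vertex, these common vertices differ, and other pairs of blocks are disjoint (\<open>snake_blocks\<close>).
  The order comes from the block-cutpoint graph; that there are no further intersections comes
  from the maximality of blocks, because a ring of nonseparable graphs is nonseparable
  (\<open>ring_nonseparable\<close>).

  The labelling grows along this list.  An \<open>\<alpha>\<close>-labelling is a graceful labelling with a threshold \<open>t\<close>
  such that every edge joins a label at most \<open>t\<close> to a label above \<open>t\<close>.  Raising the labels above
  \<open>t\<close> by \<open>m\<close> raises all weights by \<open>m\<close>, and opens a gap in which a shifted \<open>\<alpha>\<close>-labelling of a graph with
  \<open>m\<close> edges fits; this produces the missing weights from 1 to \<open>m\<close> (\<open>alpha_labelling_join\<close>).  The two
  graphs may share a vertex at either end of the gap, that is, one with label \<open>t\<close> or \<open>t + 1\<close> in the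
  first graph and the smallest or the largest label, respectively, in the second.

  So every block needs an \<open>\<alpha>\<close>-labelling in which the vertex shared with its predecessor has label 0 (or,
  after complementation, the largest label), and the vertex shared with its successor has one of the two
  labels next to the threshold.  These two vertices of a cycle of length \<open>4 n\<close> can have
  any distance from 1 to \<open>2 n\<close>.  For \<open>n \<le> 6\<close> explicit labellings cover all the distances
  (\<open>alpha_cyclic_words\<close>, \<open>cycle_alpha_labelling_between\<close>); this is where the bound on \<open>n\<close> enters.
\<close>

section \<open>Connectedness and rings of nonseparable graphs\<close>

text \<open>
  That the vertices of \<open>S\<close> are mutually reachable is written \<open>S \<times> S \<subseteq> r\<^sup>*\<close>.  The relation
  \<open>r\<close> will be the adjacency of a graph with or without one vertex deleted, so the same gluing
  argument serves for connectedness and for the absence of cut vertices.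
\<close>
lemma linked_Un:
  assumes "S \<times> S \<subseteq> r\<^sup>*" "T \<times> T \<subseteq> r\<^sup>*" "S \<inter> T \<noteq> {}"
  shows "(S \<union> T) \<times> (S \<union> T) \<subseteq> r\<^sup>*"
proof -
  obtain z where z: "z \<in> S" "z \<in> T" using assms(3) by blast
  have "(u, z) \<in> r\<^sup>* \<and> (z, u) \<in> r\<^sup>*" if "u \<in> S \<union> T" for u
    using that z assms(1,2) by blast
  then show ?thesis by (blast intro: rtrancl_trans)
qed

lemma linked_chain:
  assumes "i \<le> (j::nat)"
    and "\<And>l. i \<le> l \<Longrightarrow> l \<le> j \<Longrightarrow> S l \<times> S l \<subseteq> r\<^sup>*"
    and "\<And>l. i \<le> l \<Longrightarrow> l < j \<Longrightarrow> S l \<inter> S (Suc l) \<noteq> {}"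
  shows "(\<Union>l\<in>{i..j}. S l) \<times> (\<Union>l\<in>{i..j}. S l) \<subseteq> r\<^sup>*"
  using assms
proof (induction j rule: dec_induct)
  case base
  then show ?case by simp
next
  case (step j)
  have "(\<Union>l\<in>{i..j}. S l) \<times> (\<Union>l\<in>{i..j}. S l) \<subseteq> r\<^sup>*"
    using step.prems step.IH by (meson le_SucI less_SucI)
  moreover have "S (Suc j) \<times> S (Suc j) \<subseteq> r\<^sup>*"
    using step.prems(1)[of "Suc j"] step.hyps by simp
  moreover have "(\<Union>l\<in>{i..j}. S l) \<inter> S (Suc j) \<noteq> {}"
    using step.prems(2)[of j] step.hyps by fastforce
  ultimately have "((\<Union>l\<in>{i..j}. S l) \<union> S (Suc j)) \<times> ((\<Union>l\<in>{i..j}. S l) \<union> S (Suc j)) \<subseteq> r\<^sup>*"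
    by (rule linked_Un)
  moreover have "(\<Union>l\<in>{i..Suc j}. S l) = (\<Union>l\<in>{i..j}. S l) \<union> S (Suc j)"
    using step.hyps by (auto simp: atLeastAtMostSuc_conv)
  ultimately show ?case by simp
qed

lemma nonseparableI:
  assumes "verts H \<noteq> {}" "verts H \<times> verts H \<subseteq> (adj H)\<^sup>*"
    and "\<And>x. x \<in> verts H \<Longrightarrow>
      (verts H - {x}) \<times> (verts H - {x}) \<subseteq> (adj (delete_vertex H x))\<^sup>*"
  shows "nonseparable H"
  using assms unfolding nonseparable_def connected_graph_def cut_vertex_def by blast

lemma nonseparable_linked:
  assumes "nonseparable B" "edges B \<subseteq> edges U"
  shows "verts B \<times> verts B \<subseteq> (adj U)\<^sup>*"
proof -
  have "(adj B)\<^sup>* \<subseteq> (adj U)\<^sup>*"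
    using assms(2) by (intro rtrancl_mono) (auto simp: adj_def)
  then show ?thesis
    using assms(1) unfolding nonseparable_def connected_graph_def by blast
qed

lemma nonseparable_linked_delete:
  assumes "simple_graph B" "nonseparable B" "edges B \<subseteq> edges U"
  shows "(verts B - {x}) \<times> (verts B - {x}) \<subseteq> (adj (delete_vertex U x))\<^sup>*"
proof (cases "x \<in> verts B")
  case True
  have "(adj (delete_vertex B x))\<^sup>* \<subseteq> (adj (delete_vertex U x))\<^sup>*"
    using assms(3) by (intro rtrancl_mono) (auto simp: adj_def delete_vertex_def)
  then show ?thesis
    using assms(2) True unfolding nonseparable_def connected_graph_def cut_vertex_def by blast
next
  case False
  then have "edges B \<subseteq> edges (delete_vertex U x)"
    using assms(1,3) by (auto simp: simple_graph_def delete_vertex_def)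
  then show ?thesis
    using nonseparable_linked[OF assms(2), of "delete_vertex U x"] by blast
qed

definition graph_Union :: "('i \<Rightarrow> 'a graph) \<Rightarrow> 'i set \<Rightarrow> 'a graph" where
  "graph_Union B I = Graph (\<Union>i\<in>I. verts (B i)) (\<Union>i\<in>I. edges (B i))"

lemma graph_Union_sel [simp]:
  "verts (graph_Union B I) = (\<Union>i\<in>I. verts (B i))"
  "edges (graph_Union B I) = (\<Union>i\<in>I. edges (B i))"
  by (simp_all add: graph_Union_def)

lemma simple_graph_Union:
  "finite I \<Longrightarrow> (\<And>i. i \<in> I \<Longrightarrow> simple_graph (B i)) \<Longrightarrow> simple_graph (graph_Union B I)"
  unfolding simple_graph_def by fastforce

text \<open>
  If consecutive members of a sequence of nonseparable graphs share vertices \<open>c l\<close>, and the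
  first and the last member share a further vertex \<open>v\<close>, then these graphs form a ring whose links
  are the vertices \<open>c l\<close> and \<open>v\<close>.  Deleting a vertex destroys at most one link, and a ring
  with one link removed is still a chain.  No member of such a sequence that is a proper part of the
  union can be a block; this is how unexpected intersections of blocks are excluded.
\<close>
lemma ring_nonseparable:
  assumes B: "\<And>l. i \<le> l \<Longrightarrow> l \<le> j \<Longrightarrow> simple_graph (B l) \<and> nonseparable (B l)"
    and c: "\<And>l. i \<le> l \<Longrightarrow> l < j \<Longrightarrow> c l \<in> verts (B l) \<inter> verts (B (Suc l))"
    and inj: "inj_on c {i..<j}"
    and v: "v \<in> verts (B i)" "v \<in> verts (B j)" "v \<notin> c ` {i..<j}" and "i \<le> (j::nat)"
  shows "nonseparable (graph_Union B {i..j})"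
proof -
  let ?U = "graph_Union B {i..j}"
  have sub: "edges (B l) \<subseteq> edges ?U" if "i \<le> l" "l \<le> j" for l using that by auto
  have avoiding: "(\<Union>l\<in>{a..b}. verts (B l) - {x}) \<times> (\<Union>l\<in>{a..b}. verts (B l) - {x})
      \<subseteq> (adj (delete_vertex ?U x))\<^sup>*"
    if "i \<le> a" "a \<le> b" "b \<le> j" "x \<notin> c ` {a..<b}" for a b x
  proof (rule linked_chain[OF \<open>a \<le> b\<close>])
    fix l assume "a \<le> l" "l \<le> b"
    then show "(verts (B l) - {x}) \<times> (verts (B l) - {x}) \<subseteq> (adj (delete_vertex ?U x))\<^sup>*"
      using that B[of l] sub[of l] by (intro nonseparable_linked_delete) auto
  next
    fix l assume "a \<le> l" "l < b"
    then show "(verts (B l) - {x}) \<inter> (verts (B (Suc l)) - {x}) \<noteq> {}"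
      using that c[of l] by fastforce
  qed
  show ?thesis
  proof (rule nonseparableI)
    show "verts ?U \<noteq> {}" using v(1) \<open>i \<le> j\<close> by auto
    show "verts ?U \<times> verts ?U \<subseteq> (adj ?U)\<^sup>*"
      unfolding graph_Union_sel
    proof (rule linked_chain[OF \<open>i \<le> j\<close>])
      fix l assume "i \<le> l" "l \<le> j"
      then show "verts (B l) \<times> verts (B l) \<subseteq> (adj ?U)\<^sup>*"
        using B[of l] sub[of l] by (intro nonseparable_linked) auto
    qed (use c in blast)
    fix x assume "x \<in> verts ?U"
    have "(\<Union>l\<in>{i..j}. verts (B l) - {x}) \<times> (\<Union>l\<in>{i..j}. verts (B l) - {x})
      \<subseteq> (adj (delete_vertex ?U x))\<^sup>*"
    proof (cases "x \<in> c ` {i..<j}")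
      case False
      then show ?thesis using avoiding[of i j] \<open>i \<le> j\<close> by simp
    next
      case True
      then obtain l where l: "i \<le> l" "l < j" "x = c l" by auto
      have left: "x \<notin> c ` {i..<l}" and right: "x \<notin> c ` {Suc l..<j}"
        using inj l by (auto dest!: inj_onD)
      \<comment> \<open>The deleted vertex is the link after place \<open>l\<close>: both arcs remain, and \<open>v\<close> joins them.\<close>
      have "v \<noteq> x" using v(3) True by auto
      then have "v \<in> (\<Union>l\<in>{i..l}. verts (B l) - {x}) \<inter> (\<Union>l\<in>{Suc l..j}. verts (B l) - {x})"
        using v l by auto
      then have "((\<Union>l\<in>{i..l}. verts (B l) - {x}) \<union> (\<Union>l\<in>{Suc l..j}. verts (B l) - {x})) \<times>
          ((\<Union>l\<in>{i..l}. verts (B l) - {x}) \<union> (\<Union>l\<in>{Suc l..j}. verts (B l) - {x}))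
          \<subseteq> (adj (delete_vertex ?U x))\<^sup>*"
        using left right l by (intro linked_Un avoiding) auto
      moreover have "{i..j} = {i..l} \<union> {Suc l..j}" using l by auto
      then have "(\<Union>l\<in>{i..j}. verts (B l) - {x}) =
          (\<Union>l\<in>{i..l}. verts (B l) - {x}) \<union> (\<Union>l\<in>{Suc l..j}. verts (B l) - {x})"
        by (simp only: UN_Un)
      ultimately show ?thesis by (simp only:)
    qed
    then show "(verts ?U - {x}) \<times> (verts ?U - {x}) \<subseteq> (adj (delete_vertex ?U x))\<^sup>*"
      by simp
  qed
qed

section \<open>Blocks\<close>

lemma simple_graph_finite_edges: "simple_graph G \<Longrightarrow> finite (edges G)"
  unfolding simple_graph_def by (auto intro: finite_subset[of _ "Pow (verts G)"])

text \<open>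
  By finiteness, a nonseparable subgraph with the largest total number of vertices and edges among
  those containing \<open>H\<close> is maximal with respect to inclusion.
\<close>
lemma nonseparable_subgraph_in_block:
  assumes G: "simple_graph G" and H: "subgraph H G" "nonseparable H"
  obtains B where "B \<in> blocks G" "subgraph H B"
proof -
  have fin: "finite (verts G)" "finite (edges G)"
    using G by (auto simp: simple_graph_finite_edges) (simp add: simple_graph_def)
  let ?P = "\<lambda>K. subgraph H K \<and> subgraph K G \<and> nonseparable K"
  let ?m = "\<lambda>K. card (verts K) + card (edges K)"
  have "\<exists>B. ?P B \<and> (\<forall>K. ?P K \<longrightarrow> ?m K \<le> ?m B)"
  proof (rule ex_has_greatest_nat[where P = "?P" and f = "?m" and k = H and b = "Suc (?m G)"])
    show "?P H" using H by (auto simp: subgraph_def)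
    show "\<forall>K. ?P K \<longrightarrow> ?m K < Suc (?m G)"
      using fin by (auto simp: subgraph_def less_Suc_eq_le intro!: add_mono card_mono)
  qed
  then obtain B where B: "?P B" and max: "\<And>K. ?P K \<Longrightarrow> ?m K \<le> ?m B" by blast
  have "K = B" if K: "subgraph K G \<and> nonseparable K \<and> subgraph B K" for K
  proof -
    have sub: "verts B \<subseteq> verts K" "edges B \<subseteq> edges K" using K by (auto simp: subgraph_def)
    have finK: "finite (verts K)" "finite (edges K)"
      using K fin by (auto simp: subgraph_def intro: finite_subset)
    have "?P K" using B K by (auto simp: subgraph_def)
    then have "?m K \<le> ?m B" by (rule max)
    moreover have "card (verts B) \<le> card (verts K)" "card (edges B) \<le> card (edges K)"
      using sub finK by (auto intro: card_mono)
    ultimately have "card (verts B) = card (verts K)" "card (edges B) = card (edges K)" by auto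
    then show "K = B"
      using sub finK by (metis card_subset_eq graph.expand)
  qed
  then show thesis using that[of B] B by (auto simp: blocks_def)
qed

text \<open>
  A single vertex and a single edge are nonseparable graphs, and hence lie in blocks.
\<close>
lemma blocks_cover:
  assumes G: "simple_graph G"
  shows "(\<Union>B\<in>blocks G. verts B) = verts G" "(\<Union>B\<in>blocks G. edges B) = edges G"
proof -
  have le: "subgraph B G" if "B \<in> blocks G" for B using that by (simp add: blocks_def)
  have "\<exists>B\<in>blocks G. v \<in> verts B" if "v \<in> verts G" for v
  proof -
    let ?H = "Graph {v} {}"
    have "subgraph ?H G" using that by (simp add: subgraph_def simple_graph_def)
    moreover have "nonseparable ?H" by (rule nonseparableI) auto
    ultimately show ?thesis
      by (rule nonseparable_subgraph_in_block[OF G]) (auto simp: subgraph_def)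
  qed
  then show "(\<Union>B\<in>blocks G. verts B) = verts G" using le by (auto simp: subgraph_def)
  have "\<exists>B\<in>blocks G. e \<in> edges B" if e: "e \<in> edges G" for e
  proof -
    obtain u w where uw: "e = {u, w}" "u \<noteq> w"
      using G e by (auto simp: simple_graph_def card_2_iff)
    let ?H = "Graph {u, w} {{u, w}}"
    have "subgraph ?H G"
      using e uw G by (auto simp: subgraph_def simple_graph_def)
    moreover have "nonseparable ?H"
    proof (rule nonseparableI)
      have "(u, w) \<in> adj ?H" "(w, u) \<in> adj ?H" by (auto simp: adj_def)
      then show "verts ?H \<times> verts ?H \<subseteq> (adj ?H)\<^sup>*" by auto
    qed (use uw in auto)
    ultimately show ?thesis
      by (rule nonseparable_subgraph_in_block[OF G]) (auto simp: subgraph_def uw)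
  qed
  then show "(\<Union>B\<in>blocks G. edges B) = edges G" using le by (auto simp: subgraph_def)
qed

section \<open>Listing the blocks of a snake\<close>

text \<open>
  Along a path, blocks and cut vertices alternate, since every edge of the block-cutpoint graph joins
  one of each.  Reading off the two kinds gives the sequences \<open>B\<close> and \<open>c\<close>.  The last property holds
  because a cut vertex in \<open>B i\<close> and \<open>B j\<close> is a neighbour of both in the path.  Vertices that are not
  cut vertices are not visible in the block-cutpoint graph, so it says nothing about those that two
  blocks may share.
\<close>
lemma path_shaped_blocks:
  assumes path: "is_path (block_cutpoint_graph G)" and "blocks G \<noteq> {}"
  obtains K B c where "(0::nat) < K" "bij_betw B {..<K} (blocks G)"
    "\<And>l. Suc l < K \<Longrightarrow> c l \<in> verts (B l) \<inter> verts (B (Suc l))"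
    "\<And>l. Suc l < K \<Longrightarrow> cut_vertex G (c l)" "inj_on c {l. Suc l < K}"
    "\<And>i j v. \<lbrakk>cut_vertex G v; i < j; j < K; v \<in> verts (B i); v \<in> verts (B j)\<rbrakk>
       \<Longrightarrow> j = Suc i \<and> v = c i"
proof -
  let ?X = "Inl ` blocks G \<union> Inr ` {v. cut_vertex G v}"
  obtain p \<phi> where bij: "bij_betw \<phi> {..<p} ?X"
    and E: "edges (block_cutpoint_graph G) = (\<lambda>e. \<phi> ` e) ` {{i, Suc i} | i. Suc i < p}"
    using path unfolding is_path_def isomorphic_def standard_path_def
    by (auto simp: block_cutpoint_graph_def)
  have inj: "\<phi> a = \<phi> b \<longleftrightarrow> a = b" if "a < p" "b < p" for a b
    using bij that by (auto simp: bij_betw_def inj_on_def)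
  have step: "\<exists>B v. {\<phi> a, \<phi> (Suc a)} = {Inl B, Inr v} \<and> B \<in> blocks G \<and> v \<in> verts B"
    if "Suc a < p" for a
  proof -
    have "\<phi> ` {a, Suc a} \<in> edges (block_cutpoint_graph G)" unfolding E using that by blast
    then show ?thesis by (auto simp: block_cutpoint_graph_def)
  qed
  have adjacent: "b = Suc a \<or> a = Suc b"
    if ab: "\<phi> a = Inl C" "\<phi> b = Inr v" "a < p" "b < p" "C \<in> blocks G" "cut_vertex G v" "v \<in> verts C"
    for a b C v
  proof -
    have "{Inl C, Inr v} \<in> edges (block_cutpoint_graph G)"
      using that by (auto simp: block_cutpoint_graph_def)
    then obtain q where "Suc q < p" "{\<phi> a, \<phi> b} = {\<phi> q, \<phi> (Suc q)}"
      using ab(1,2) unfolding E by auto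
    then show ?thesis using inj that(3,4) by (auto simp: doubleton_eq_iff)
  qed
  have alt: "isl (\<phi> (Suc a)) \<longleftrightarrow> \<not> isl (\<phi> a)" if "Suc a < p" for a
    using step[OF that] by (auto simp: doubleton_eq_iff)
  have parity: "isl (\<phi> a) \<longleftrightarrow> (even a \<longleftrightarrow> isl (\<phi> 0))" if "a < p" for a
    using that by (induction a) (auto simp: alt)
  \<comment> \<open>The path might start with a cut vertex; then the first block has position 1.\<close>
  define s where "s = (if isl (\<phi> 0) then 0 else Suc 0)"
  have isl: "isl (\<phi> a) \<longleftrightarrow> even (s + a)" if "a < p" for a
    using parity[OF that] by (auto simp: s_def)
  define K where "K = (p - s + 1) div 2"
  define B where "B = (\<lambda>l. projl (\<phi> (s + 2 * l)))"
  define c where "c = (\<lambda>l. projr (\<phi> (s + 2 * l + 1)))"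
  have ltK: "l < K \<longleftrightarrow> s + 2 * l < p" for l unfolding K_def by auto
  have \<phi>B: "\<phi> (s + 2 * l) = Inl (B l)" if "l < K" for l
    using isl[of "s + 2 * l"] that by (simp add: ltK B_def)
  have \<phi>c: "\<phi> (s + 2 * l + 1) = Inr (c l)" if "s + 2 * l + 1 < p" for l
    using isl[of "s + 2 * l + 1"] that by (auto simp: c_def)
  have Bl: "B l \<in> blocks G" if "l < K" for l
    using \<phi>B[OF that] bij_betwE[OF bij] that by (force simp: ltK)
  have onto: "\<exists>l<K. B l = C" if C: "C \<in> blocks G" for C
  proof -
    have "Inl C \<in> \<phi> ` {..<p}" using C bij by (simp add: bij_betw_imp_surj_on)
    then obtain a where a: "a < p" "\<phi> a = Inl C" by auto
    then have "even (s + a)" using isl[of a] by simp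
    moreover have "s \<le> a" using calculation by (auto simp: s_def Suc_le_eq intro: Nat.gr0I)
    ultimately have "even (a - s)" by (simp add: even_diff_nat add.commute)
    then obtain l where "a - s = 2 * l" by (rule evenE)
    with \<open>s \<le> a\<close> have "a = s + 2 * l" by simp
    then show ?thesis using a \<phi>B[of l] ltK[of l] by auto
  qed
  show thesis
  proof (rule that)
    show "0 < K" using onto \<open>blocks G \<noteq> {}\<close> by (metis ex_in_conv gr0I not_less0)
    show "bij_betw B {..<K} (blocks G)"
    proof (rule bij_betw_imageI)
      show "inj_on B {..<K}"
      proof (rule inj_onI)
        fix i j assume "i \<in> {..<K}" "j \<in> {..<K}" "B i = B j"
        then have "\<phi> (s + 2 * i) = \<phi> (s + 2 * j)" using \<phi>B by simp
        then show "i = j" using \<open>i \<in> {..<K}\<close> \<open>j \<in> {..<K}\<close> inj by (simp add: ltK)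
      qed
      show "B ` {..<K} = blocks G" using Bl onto by auto
    qed
    show "c l \<in> verts (B l) \<inter> verts (B (Suc l))" if "Suc l < K" for l
    proof -
      have p: "s + 2 * l + 2 < p" using that by (simp add: ltK)
      have "\<phi> (s + 2 * l) = Inl (B l)" "\<phi> (Suc (s + 2 * l)) = Inr (c l)"
        "\<phi> (Suc (Suc (s + 2 * l))) = Inl (B (Suc l))"
        using \<phi>B[of l] \<phi>c[of l] \<phi>B[of "Suc l"] that p by simp_all
      then show ?thesis
        using step[of "s + 2 * l"] step[of "Suc (s + 2 * l)"] p
        by (auto simp: doubleton_eq_iff)
    qed
    show "cut_vertex G (c l)" if "Suc l < K" for l
    proof -
      have "s + 2 * l + 1 < p" using that by (simp add: ltK)
      then have "Inr (c l) \<in> ?X" using \<phi>c[of l] bij_betwE[OF bij] by (metis lessThan_iff)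
      then show ?thesis by auto
    qed
    show "inj_on c {l. Suc l < K}"
    proof (rule inj_onI)
      fix i j assume ij: "i \<in> {l. Suc l < K}" "j \<in> {l. Suc l < K}" "c i = c j"
      then have "s + 2 * i + 1 < p" "s + 2 * j + 1 < p" by (simp_all add: ltK)
      moreover from this have "\<phi> (s + 2 * i + 1) = \<phi> (s + 2 * j + 1)"
        using ij(3) \<phi>c by simp
      ultimately show "i = j" using inj by simp
    qed
    show "j = Suc i \<and> v = c i"
      if "cut_vertex G v" "i < j" "j < K" "v \<in> verts (B i)" "v \<in> verts (B j)" for i j v
    proof -
      have "Inr v \<in> \<phi> ` {..<p}" using that(1) bij by (simp add: bij_betw_imp_surj_on)
      then obtain b where b: "b < p" "\<phi> b = Inr v" by auto
      have p: "s + 2 * i < p" "s + 2 * j < p" using that ltK[of i] ltK[of j] by auto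
      have "b = Suc (s + 2 * i) \<or> s + 2 * i = Suc b" "b = Suc (s + 2 * j) \<or> s + 2 * j = Suc b"
        using adjacent[OF \<phi>B[of i] b(2)] adjacent[OF \<phi>B[of j] b(2)] p b(1) that Bl[of i] Bl[of j]
        by auto
      then have bi: "b = s + 2 * i + 1" and "j = Suc i" using \<open>i < j\<close> by auto
      moreover have "v = c i" using b \<phi>c[of i] bi by simp
      ultimately show ?thesis by blast
    qed
  qed
qed

text \<open>
  A vertex \<open>v\<close> shared by \<open>B i\<close> and \<open>B j\<close> must be one of the vertices \<open>c l\<close> between them: otherwise
  the blocks from \<open>B i\<close> to \<open>B j\<close> would form a ring, and both would equal the nonseparable union
  of that ring by maximality.  Hence \<open>v\<close> is a cut vertex, and the block-cutpoint graph shows that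
  \<open>j = Suc i\<close>.
\<close>
lemma snake_blocks:
  assumes snake: "cyclic_snake k r G"
  obtains K B c where "(0::nat) < K"
    "\<And>i. i < K \<Longrightarrow> simple_graph (B i) \<and> is_cycle r (B i)"
    "graph_Union B {..<K} = G"
    "\<And>i. Suc i < K \<Longrightarrow> verts (B i) \<inter> verts (B (Suc i)) = {c i}"
    "\<And>i j. Suc i < j \<Longrightarrow> j < K \<Longrightarrow> verts (B i) \<inter> verts (B j) = {}"
    "\<And>i. Suc (Suc i) < K \<Longrightarrow> c (Suc i) \<noteq> c i"
proof -
  have G: "simple_graph G" and conn: "connected_graph G"
    and cyc: "\<And>C. C \<in> blocks G \<Longrightarrow> is_cycle r C"
    and path: "is_path (block_cutpoint_graph G)"
    using snake by (auto simp: cyclic_snake_def)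
  have "blocks G \<noteq> {}"
    using blocks_cover(1)[OF G] conn by (auto simp: connected_graph_def)
  with path obtain K B c where K: "(0::nat) < K" and bij: "bij_betw B {..<K} (blocks G)"
    and c: "\<And>l. Suc l < K \<Longrightarrow> c l \<in> verts (B l) \<inter> verts (B (Suc l))"
    and cutc: "\<And>l. Suc l < K \<Longrightarrow> cut_vertex G (c l)" and inj: "inj_on c {l. Suc l < K}"
    and cut: "\<And>i j v. \<lbrakk>cut_vertex G v; i < j; j < K; v \<in> verts (B i); v \<in> verts (B j)\<rbrakk>
       \<Longrightarrow> j = Suc i \<and> v = c i"
    by (rule path_shaped_blocks) blast
  have block: "B i \<in> blocks G" if "i < K" for i using bij that by (auto simp: bij_betw_def)
  have sub: "subgraph (B i) G" "simple_graph (B i)" "nonseparable (B i)" if "i < K" for i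
    using block[OF that] by (auto simp: blocks_def subgraph_def)
  have neq: "B i \<noteq> B j" if "i < j" "j < K" for i j
    using bij that by (auto simp: bij_betw_def inj_on_def)
  have shared: "j = Suc i \<and> v = c i"
    if ij: "i < j" "j < K" and v: "v \<in> verts (B i)" "v \<in> verts (B j)" for i j v
  proof -
    have "v \<in> c ` {i..<j}"
    proof (rule ccontr)
      assume ring: "v \<notin> c ` {i..<j}"
      let ?U = "graph_Union B {i..j}"
      have "nonseparable ?U"
      proof (rule ring_nonseparable)
        show "inj_on c {i..<j}" using inj by (rule inj_on_subset) (use ij in auto)
      qed (use sub c v ring ij in auto)
      moreover have U: "subgraph ?U G"
        using sub ij unfolding subgraph_def
        by (auto intro!: simple_graph_Union) (meson in_mono le_less_trans)+
      moreover have "subgraph (B l) ?U" if "l \<in> {i..j}" for l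
        using that sub ij U by (auto simp: subgraph_def)
      ultimately have "?U = B l" if "l \<in> {i..j}" for l
        using block[of l] that ij by (auto simp: blocks_def)
      from this[of i] this[of j] neq[OF ij] ij show False by simp
    qed
    then obtain l where l: "i \<le> l" "l < j" "v = c l" by auto
    have "cut_vertex G v"
      using cutc l ij by simp
    then show ?thesis using cut ij v by blast
  qed
  show thesis
  proof (rule that[OF K])
    show "simple_graph (B i) \<and> is_cycle r (B i)" if "i < K" for i
      using sub(2) cyc block that by blast
    show "graph_Union B {..<K} = G"
    proof (rule graph.expand)
      show "verts (graph_Union B {..<K}) = verts G \<and> edges (graph_Union B {..<K}) = edges G"
        using blocks_cover[OF G] by (simp flip: bij_betw_imp_surj_on[OF bij])
    qed
    show "verts (B i) \<inter> verts (B (Suc i)) = {c i}" if "Suc i < K" for i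
      using c[OF that] shared[OF lessI that] by blast
    show "verts (B i) \<inter> verts (B j) = {}" if "Suc i < j" "j < K" for i j
      using shared[of i j] that by auto
    show "c (Suc i) \<noteq> c i" if "Suc (Suc i) < K" for i
      using inj that by (auto dest: inj_onD)
  qed
qed

section \<open>Labellings with a threshold\<close>

text \<open>
  The weight that the labelling \<open>f\<close> induces on an edge, as a function of the edge itself.
\<close>
definition spread :: "('a \<Rightarrow> nat) \<Rightarrow> 'a set \<Rightarrow> nat" where
  "spread f e = Max (f ` e) - Min (f ` e)"

lemma spread_doubleton: "spread f {u, v} = (f u - f v) + (f v - f u)"
  by (simp add: spread_def max_def min_def)

text \<open>
  Rosa's \<open>\<alpha>\<close>-labellings: graceful labellings for which every edge joins a small label, at most the
  threshold \<open>t\<close>, to a large one.  Raising all large labels by the same number therefore raises all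
  weights by this number.  That \<open>spread f\<close> is injective on the edges follows from its image by counting.
\<close>
definition alpha_labelling :: "'a graph \<Rightarrow> nat \<Rightarrow> ('a \<Rightarrow> nat) \<Rightarrow> bool" where
  "alpha_labelling G t f \<longleftrightarrow>
     f ` verts G \<subseteq> {0..card (edges G)} \<and> inj_on f (verts G) \<and>
     (\<forall>e\<in>edges G. \<exists>u v. e = {u, v} \<and> f u \<le> t \<and> t < f v) \<and>
     spread f ` edges G = {1..card (edges G)}"

lemma alpha_labelling_graceful:
  assumes "alpha_labelling G t f"
  shows "graceful G"
proof -
  have img: "spread f ` edges G = {1..card (edges G)}"
    using assms by (simp add: alpha_labelling_def)
  have "finite (edges G)"
  proof (cases "card (edges G) = 0")
    case True
    then show ?thesis using img by simp
  qed (simp add: card_ge_0_finite)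
  then have "bij_betw (spread f) (edges G) {1..card (edges G)}"
    using img by (simp add: bij_betw_def eq_card_imp_inj_on)
  moreover have "int (spread f {u, v}) = \<bar>int (f u) - int (f v)\<bar>" for u v
    by (simp add: spread_doubleton)
  moreover have "f ` verts G \<subseteq> {0..card (edges G)}" "inj_on f (verts G)"
    using assms by (simp_all add: alpha_labelling_def)
  ultimately have "graceful_labelling G f"
    unfolding graceful_labelling_def by (intro conjI exI[of _ "spread f"]) simp_all
  then show ?thesis unfolding graceful_def by blast
qed

lemma alpha_labelling_edge:
  assumes G: "simple_graph G" and f: "alpha_labelling G t f" and e: "e \<in> edges G"
  obtains u v where "e = {u, v}" "u \<in> verts G" "v \<in> verts G"
    "f u \<le> t" "t < f v" "f v \<le> card (edges G)"
proof -
  have "\<exists>u v. e = {u, v} \<and> f u \<le> t \<and> t < f v"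
    using f e by (simp add: alpha_labelling_def)
  then obtain u v where uv: "e = {u, v}" "f u \<le> t" "t < f v" by blast
  moreover have "u \<in> verts G" and v: "v \<in> verts G"
    using G e uv(1) by (auto simp: simple_graph_def)
  moreover have "f v \<le> card (edges G)"
    using f v by (auto simp: alpha_labelling_def)
  ultimately show thesis using that by blast
qed

lemma alpha_labelling_threshold_less:
  assumes "simple_graph G" "alpha_labelling G t f" "edges G \<noteq> {}"
  shows "t < card (edges G)"
proof -
  obtain e where "e \<in> edges G" using assms(3) by blast
  with assms(1,2) show ?thesis by (rule alpha_labelling_edge) simp
qed

text \<open>
  Subtracting all labels from the number of edges exchanges small and large labels.  It turns a vertex
  labelled 0 into one with the largest label, and the labels \<open>t\<close> and \<open>Suc t\<close> next to the threshold
  into the labels next to the new threshold.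
\<close>
lemma alpha_labelling_complement:
  assumes G: "simple_graph G" and f: "alpha_labelling G t f" and ne: "edges G \<noteq> {}"
  shows "alpha_labelling G (card (edges G) - Suc t) (\<lambda>v. card (edges G) - f v)"
proof -
  let ?m = "card (edges G)" and ?f = "\<lambda>v. card (edges G) - f v"
  have t: "t < ?m" by (rule alpha_labelling_threshold_less[OF G f ne])
  have le: "f v \<le> ?m" if "v \<in> verts G" for v
    using f that by (auto simp: alpha_labelling_def)
  have "spread ?f e = spread f e" if "e \<in> edges G" for e
    using G f that by (rule alpha_labelling_edge) (auto simp: spread_doubleton)
  then have "spread ?f ` edges G = {1..?m}"
    using f by (simp add: alpha_labelling_def)
  moreover have "inj_on ?f (verts G)"
  proof (rule inj_onI)
    fix u v assume uv: "u \<in> verts G" "v \<in> verts G" "?f u = ?f v"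
    then have "f u = f v" using le[of u] le[of v] by simp
    then show "u = v" using f uv by (auto simp: alpha_labelling_def dest: inj_onD)
  qed
  moreover have "\<exists>u v. e = {u, v} \<and> ?f u \<le> ?m - Suc t \<and> ?m - Suc t < ?f v"
    if e: "e \<in> edges G" for e
  proof -
    obtain u v where uv: "e = {u, v}" "f u \<le> t" "t < f v" "f v \<le> ?m"
      by (rule alpha_labelling_edge[OF G f e])
    then have "e = {v, u}" "?f v \<le> ?m - Suc t" "?m - Suc t < ?f u"
      using t by auto
    then show ?thesis by (intro exI conjI)
  qed
  ultimately show ?thesis by (auto simp: alpha_labelling_def)
qed

text \<open>
  Raise the large labels of \<open>H\<close> by the number \<open>m\<close> of edges of \<open>K\<close>.  The weights on \<open>H\<close> then exceed
  \<open>m\<close>, and the labels of \<open>K\<close>, shifted by \<open>\<delta>\<close>, lie in the gap opened at the threshold.  They meet the labels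
  of \<open>H\<close> at one end of the gap only: at its lower end if the common vertex has label \<open>s\<close> in \<open>H\<close>
  and 0 in \<open>K\<close>, and at its upper end if it has label \<open>Suc s\<close> in \<open>H\<close> and the largest label in
  \<open>K\<close>.  Since the new threshold is that of \<open>K\<close>, shifted like its labels, the construction can be repeated.
\<close>
lemma alpha_labelling_join:
  assumes H: "simple_graph H" and f: "alpha_labelling H s f"
    and K: "simple_graph K" and g: "alpha_labelling K t g" and ne: "edges K \<noteq> {}"
    and x: "verts H \<inter> verts K = {x}"
    and glue: "f x = s \<and> g x = 0 \<or> f x = Suc s \<and> g x = card (edges K)"
    and J: "verts J = verts H \<union> verts K" "edges J = edges H \<union> edges K"
  obtains \<delta> h where "alpha_labelling J (t + \<delta>) h" "\<And>y. y \<in> verts K \<Longrightarrow> h y = g y + \<delta>"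
proof -
  define m where "m = card (edges K)"
  define \<delta> where "\<delta> = (if f x = s then s else Suc s)"
  define lift where "lift = (\<lambda>a. if a \<le> s then a else a + m)"
  define h where "h = (\<lambda>v. if v \<in> verts H then lift (f v) else g v + \<delta>)"
  have glue': "f x = s \<and> g x = 0 \<and> \<delta> = s \<or> f x = Suc s \<and> g x = m \<and> \<delta> = Suc s"
    using glue by (auto simp: \<delta>_def m_def)
  have tm: "t < m" unfolding m_def by (rule alpha_labelling_threshold_less[OF K g ne])
  have hH: "h v = lift (f v)" if "v \<in> verts H" for v using that by (simp add: h_def)
  have hK: "h v = g v + \<delta>" if "v \<in> verts K" for v
  proof (cases "v \<in> verts H")
    case True
    then have "v = x" using x that by blast
    then show ?thesis using glue' True by (auto simp: h_def lift_def)
  qed (simp add: h_def)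
  have edgeH: "e \<subseteq> verts H" "card e = 2" if "e \<in> edges H" for e
    using H that by (auto simp: simple_graph_def)
  have edgeK: "e \<subseteq> verts K" "card e = 2" if "e \<in> edges K" for e
    using K that by (auto simp: simple_graph_def)
  have splitH: "\<exists>u v. e = {u, v} \<and> u \<in> verts H \<and> v \<in> verts H \<and> f u \<le> s \<and> s < f v"
    if "e \<in> edges H" for e
    using H f that by (rule alpha_labelling_edge) blast
  have splitK: "\<exists>u v. e = {u, v} \<and> u \<in> verts K \<and> v \<in> verts K \<and> g u \<le> t \<and> t < g v"
    if "e \<in> edges K" for e
    using K g that by (rule alpha_labelling_edge) blast
  have fin: "finite (edges H)" "finite (edges K)"
    using H K by (simp_all add: simple_graph_finite_edges)
  have "edges H \<inter> edges K = {}"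
  proof (rule ccontr)
    assume "edges H \<inter> edges K \<noteq> {}"
    then obtain e where "e \<in> edges H" "e \<in> edges K" by blast
    then have "e \<subseteq> {x}" "card e = 2" using edgeH edgeK x by blast+
    then show False using card_mono[of "{x}" e] by simp
  qed
  then have cardJ: "card (edges J) = card (edges H) + m"
    unfolding J m_def using fin by (simp add: card_Un_disjoint)
  have fle: "f v \<le> card (edges H)" if "v \<in> verts H" for v
    using f that by (auto simp: alpha_labelling_def)
  have gle: "g v \<le> m" if "v \<in> verts K" for v
    using g that by (auto simp: alpha_labelling_def m_def)
  have xHK: "x \<in> verts H" "x \<in> verts K" using x by auto
  have \<delta>le: "\<delta> \<le> card (edges H)" using glue' fle[OF xHK(1)] by auto
  have "h ` verts J \<subseteq> {0..card (edges J)}"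
  proof -
    have "h v \<le> card (edges H) + m" if "v \<in> verts H" for v
      using fle[OF that] by (simp add: hH that lift_def)
    moreover have "h v \<le> card (edges H) + m" if "v \<in> verts K" for v
      using gle[OF that] \<delta>le by (simp add: hK that)
    ultimately show ?thesis unfolding cardJ J(1) by auto
  qed
  moreover have "inj_on h (verts J)"
  proof -
    have injf: "inj_on f (verts H)" and injg: "inj_on g (verts K)"
      using f g by (auto simp: alpha_labelling_def)
    have injH: "inj_on h (verts H)"
    proof (rule inj_onI)
      fix u v assume uv: "u \<in> verts H" "v \<in> verts H" "h u = h v"
      then have "f u = f v" by (auto simp: hH lift_def split: if_splits)
      then show "u = v" using injf uv by (auto dest: inj_onD)
    qed
    have injK: "inj_on h (verts K)"
      using injg by (auto simp: hK inj_on_def)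
    have cross: "u = w" if u: "u \<in> verts H" and w: "w \<in> verts K" and eq: "h u = h w" for u w
    proof -
      have "f u = f x \<and> g w = g x"
        using glue' eq gle[OF w] by (auto simp: hH[OF u] hK[OF w] lift_def split: if_splits)
      then have "u = x" "w = x" using injf injg u w xHK by (auto dest: inj_onD)
      then show ?thesis by simp
    qed
    show ?thesis
    proof (rule inj_onI)
      fix u w assume uw: "u \<in> verts J" "w \<in> verts J" "h u = h w"
      then consider "u \<in> verts H" "w \<in> verts H" | "u \<in> verts K" "w \<in> verts K"
        | "u \<in> verts H" "w \<in> verts K" | "w \<in> verts H" "u \<in> verts K"
        unfolding J by blast
      then show "u = w"
      proof cases
        case 1
        then show ?thesis by (rule inj_onD[OF injH uw(3)])
      next
        case 2
        then show ?thesis by (rule inj_onD[OF injK uw(3)])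
      next
        case 3
        then show ?thesis using uw(3) by (rule cross)
      next
        case 4
        then show ?thesis using uw(3)[symmetric] by (rule cross[symmetric])
      qed
    qed
  qed
  moreover have "\<exists>u v. e = {u, v} \<and> h u \<le> t + \<delta> \<and> t + \<delta> < h v" if "e \<in> edges J" for e
  proof (cases "e \<in> edges H")
    case True
    then obtain u v where uv: "e = {u, v}" "u \<in> verts H" "v \<in> verts H" "f u \<le> s" "s < f v"
      by (elim exE[OF splitH] exE conjE)
    then have "h u \<le> t + \<delta>" "t + \<delta> < h v"
      using glue' tm by (auto simp: hH lift_def)
    with uv(1) show ?thesis by (intro exI conjI)
  next
    case False
    with that have "e \<in> edges K" by (simp add: J)
    then obtain u v where uv: "e = {u, v}" "u \<in> verts K" "v \<in> verts K" "g u \<le> t" "t < g v"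
      by (elim exE[OF splitK] exE conjE)
    then have "h u \<le> t + \<delta>" "t + \<delta> < h v" by (simp_all add: hK)
    with uv(1) show ?thesis by (intro exI conjI)
  qed
  moreover have "spread h ` edges J = {1..card (edges J)}"
  proof -
    have "spread h e = spread f e + m" if e: "e \<in> edges H" for e
      using splitH[OF e] by (auto simp: spread_doubleton hH lift_def)
    then have "spread h ` edges H = (\<lambda>a. a + m) ` spread f ` edges H"
      by (auto simp: image_image)
    moreover have "spread h e = spread g e" if "e \<in> edges K" for e
      using splitK[OF that] by (auto simp: spread_doubleton hK)
    then have "spread h ` edges K = spread g ` edges K" by simp
    ultimately have "spread h ` edges J = {1 + m..card (edges H) + m} \<union> {1..m}"
      using f g unfolding J image_Un by (simp add: alpha_labelling_def m_def)
    then show ?thesis unfolding cardJ by auto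
  qed
  ultimately have "alpha_labelling J (t + \<delta>) h" by (auto simp: alpha_labelling_def)
  then show thesis using hK by (rule that)
qed

text \<open>
  In the union of the first graphs, the vertex at which the next graph is attached needs a label next to
  the threshold.  If \<open>B i\<close> can be labelled with 0 at the vertex where it is attached, and with a
  label next to its threshold at any other prescribed vertex, then the complement of such a labelling
  has the largest label at the first vertex instead; one of the two fits whichever side of the threshold
  the label of the common vertex is on.  The prescribed vertex is the next common vertex, which is
  why consecutive ones must differ.
\<close>
lemma alpha_labelling_chain:
  fixes B :: "nat \<Rightarrow> 'a graph"
  assumes simple: "\<And>i. i < K \<Longrightarrow> simple_graph (B i)"
    and ne: "\<And>i. i < K \<Longrightarrow> edges (B i) \<noteq> {}"
    and ext: "\<And>i a b. \<lbrakk>i < K; a \<in> verts (B i); b \<in> verts (B i); a \<noteq> b\<rbrakk> \<Longrightarrow>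
      \<exists>t f. alpha_labelling (B i) t f \<and> f a = 0 \<and> (f b = t \<or> f b = Suc t)"
    and consecutive: "\<And>i. Suc i < K \<Longrightarrow> verts (B i) \<inter> verts (B (Suc i)) = {c i}"
    and disjoint: "\<And>i j. Suc i < j \<Longrightarrow> j < K \<Longrightarrow> verts (B i) \<inter> verts (B j) = {}"
    and distinct: "\<And>i. Suc (Suc i) < K \<Longrightarrow> c (Suc i) \<noteq> c i"
    and "0 < K"
  shows "\<exists>t f. alpha_labelling (graph_Union B {..<K}) t f"
proof -
  have two: "\<exists>a b. a \<in> verts (B i) \<and> b \<in> verts (B i) \<and> a \<noteq> b" if "i < K" for i
    using simple[OF that] ne[OF that] by (fastforce simp: simple_graph_def card_2_iff)
  then have other: "\<exists>a\<in>verts (B i). a \<noteq> b" if "i < K" for i b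
    using that by metis
  have ext_top: "\<exists>t f. alpha_labelling (B i) t f \<and> f a = card (edges (B i)) \<and> (f b = t \<or> f b = Suc t)"
    if i: "i < K" and ab: "a \<in> verts (B i)" "b \<in> verts (B i)" "a \<noteq> b" for i a b
  proof -
    obtain t f where f: "alpha_labelling (B i) t f" "f a = 0" "f b = t \<or> f b = Suc t"
      using ext[OF i ab] by blast
    have "t < card (edges (B i))"
      by (rule alpha_labelling_threshold_less[OF simple[OF i] f(1) ne[OF i]])
    then have "card (edges (B i)) - f b = card (edges (B i)) - Suc t \<or>
        card (edges (B i)) - f b = Suc (card (edges (B i)) - Suc t)"
      using f(3) by auto
    moreover have "card (edges (B i)) - f a = card (edges (B i))" using f(2) by simp
    ultimately show ?thesis
      using alpha_labelling_complement[OF simple[OF i] f(1) ne[OF i]] by blast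
  qed
  have "\<exists>t h. alpha_labelling (graph_Union B {..j}) t h \<and> (h b = t \<or> h b = Suc t)"
    if "j < K" "b \<in> verts (B j)" "\<And>i. j = Suc i \<Longrightarrow> b \<noteq> c i" for j b
    using that
  proof (induction j arbitrary: b)
    case 0
    then obtain a where "a \<in> verts (B 0)" "a \<noteq> b" using other by blast
    moreover have "graph_Union B {..0} = B 0" by (simp add: graph_Union_def)
    ultimately show ?case using ext[of 0 a b] 0 by auto
  next
    case (Suc j)
    let ?H = "graph_Union B {..j}"
    have cj: "c j \<in> verts (B j)" "c j \<in> verts (B (Suc j))"
      using consecutive[of j] Suc.prems(1) by auto
    have "\<exists>t h. alpha_labelling ?H t h \<and> (h (c j) = t \<or> h (c j) = Suc t)"
      using Suc.prems(1) cj(1) distinct by (intro Suc.IH) auto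
    then obtain s f where f: "alpha_labelling ?H s f" "f (c j) = s \<or> f (c j) = Suc s" by blast
    have b: "c j \<noteq> b" using Suc.prems(3) by auto
    obtain t g where g: "alpha_labelling (B (Suc j)) t g" "g b = t \<or> g b = Suc t"
      and glue: "f (c j) = s \<and> g (c j) = 0 \<or> f (c j) = Suc s \<and> g (c j) = card (edges (B (Suc j)))"
      using f(2) ext[OF Suc.prems(1) cj(2) Suc.prems(2) b]
        ext_top[OF Suc.prems(1) cj(2) Suc.prems(2) b] by metis
    have meet: "verts ?H \<inter> verts (B (Suc j)) = {c j}"
    proof -
      have "verts (B i) \<inter> verts (B (Suc j)) \<subseteq> {c j}" if "i \<le> j" for i
        using consecutive[of j] disjoint[of i "Suc j"] Suc.prems(1) that
        by (cases "i = j") auto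
      then show ?thesis using cj by auto
    qed
    have H: "simple_graph ?H"
      using simple Suc.prems(1) by (intro simple_graph_Union) auto
    obtain \<delta> h where h: "alpha_labelling (graph_Union B {..Suc j}) (t + \<delta>) h"
      "\<And>y. y \<in> verts (B (Suc j)) \<Longrightarrow> h y = g y + \<delta>"
    proof (rule alpha_labelling_join[OF H f(1) simple[OF Suc.prems(1)] g(1) ne[OF Suc.prems(1)] meet glue])
      show "verts (graph_Union B {..Suc j}) = verts ?H \<union> verts (B (Suc j))"
        "edges (graph_Union B {..Suc j}) = edges ?H \<union> edges (B (Suc j))"
        by (auto simp: atMost_Suc)
    qed (rule that)
    have "h b = t + \<delta> \<or> h b = Suc (t + \<delta>)" using h(2)[OF Suc.prems(2)] g(2) by auto
    then show ?case using h(1) by blast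
  qed
  moreover obtain j where j: "K = Suc j" using \<open>0 < K\<close> by (cases K) auto
  moreover have "\<exists>b\<in>verts (B j). \<forall>i. j = Suc i \<longrightarrow> b \<noteq> c i"
    using other[of j] j by (cases j) auto
  ultimately have "\<exists>t h. alpha_labelling (graph_Union B {..j}) t h" by blast
  then show ?thesis by (simp add: j lessThan_Suc_atMost)
qed

section \<open>Labellings of cycles\<close>

definition enumerates_cycle :: "(nat \<Rightarrow> 'a) \<Rightarrow> nat \<Rightarrow> 'a graph \<Rightarrow> bool" where
  "enumerates_cycle h r C \<longleftrightarrow> bij_betw h {..<r} (verts C) \<and>
     edges C = (\<lambda>i. {h i, h (Suc i mod r)}) ` {..<r}"

lemma bij_betw_rotate:
  assumes "p < (r::nat)"
  shows "bij_betw (\<lambda>i. (p + i) mod r) {..<r} {..<r}"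
proof -
  have "inj_on (\<lambda>i. (p + i) mod r) {..<r}"
    using assms by (auto simp: inj_on_def mod_if split: if_splits)
  then show ?thesis
    using assms by (intro bij_betw_imageI endo_inj_surj) auto
qed

lemma enumerates_cycle_rotate:
  assumes h: "enumerates_cycle h r C" and p: "p < r"
  shows "enumerates_cycle (\<lambda>i. h ((p + i) mod r)) r C"
proof -
  let ?\<sigma> = "\<lambda>i. (p + i) mod r" and ?E = "\<lambda>i. {h i, h (Suc i mod r)}"
  have \<sigma>: "bij_betw ?\<sigma> {..<r} {..<r}" by (rule bij_betw_rotate[OF p])
  then have "bij_betw (\<lambda>i. h (?\<sigma> i)) {..<r} (verts C)"
    using h bij_betw_trans[OF \<sigma>, of h] by (simp add: enumerates_cycle_def comp_def)
  moreover have "{h (?\<sigma> i), h (?\<sigma> (Suc i mod r))} = ?E (?\<sigma> i)" for i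
    by (simp add: mod_simps)
  then have "(\<lambda>i. {h (?\<sigma> i), h (?\<sigma> (Suc i mod r))}) ` {..<r} = ?E ` ?\<sigma> ` {..<r}"
    by (simp add: image_image)
  then have "(\<lambda>i. {h (?\<sigma> i), h (?\<sigma> (Suc i mod r))}) ` {..<r} = edges C"
    using h \<sigma> by (simp add: bij_betw_imp_surj_on enumerates_cycle_def)
  ultimately show ?thesis unfolding enumerates_cycle_def by metis
qed

lemma enumerates_cycle_reverse:
  assumes h: "enumerates_cycle h r C"
  shows "enumerates_cycle (\<lambda>i. h ((r - i) mod r)) r C"
proof -
  let ?\<sigma> = "\<lambda>i. (r - i) mod r" and ?E = "\<lambda>i. {h i, h (Suc i mod r)}"
  have "inj_on ?\<sigma> {..<r}" by (auto simp: inj_on_def mod_if split: if_splits)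
  then have \<sigma>: "bij_betw ?\<sigma> {..<r} {..<r}"
    by (intro bij_betw_imageI endo_inj_surj) auto
  then have "bij_betw (\<lambda>i. h (?\<sigma> i)) {..<r} (verts C)"
    using h bij_betw_trans[OF \<sigma>, of h] by (simp add: enumerates_cycle_def comp_def)
  moreover have "{h (?\<sigma> i), h (?\<sigma> (Suc i mod r))} = ?E (r - Suc i)" if "i < r" for i
  proof -
    have "Suc (r - Suc i) mod r = ?\<sigma> i" "?\<sigma> (Suc i mod r) = r - Suc i"
      using that by (auto simp: mod_if Suc_diff_Suc)
    then show ?thesis by auto
  qed
  then have "(\<lambda>i. {h (?\<sigma> i), h (?\<sigma> (Suc i mod r))}) ` {..<r} = ?E ` (\<lambda>i. r - Suc i) ` {..<r}"
    by (simp add: image_image)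
  moreover have "(\<lambda>i. r - Suc i) ` {..<r} = {..<r}"
    by (rule endo_inj_surj) (auto simp: inj_on_def)
  ultimately show ?thesis
    using h unfolding enumerates_cycle_def by metis
qed

lemma is_cycle_enumerates:
  assumes "is_cycle r C"
  obtains h where "enumerates_cycle h r C"
proof -
  obtain h where "bij_betw h {..<r} (verts C)"
    and E: "edges C = (\<lambda>e. h ` e) ` {{i, Suc i mod r} | i. i < r}"
    using assms unfolding is_cycle_def isomorphic_def standard_cycle_def by auto
  moreover have "edges C = (\<lambda>i. {h i, h (Suc i mod r)}) ` {..<r}"
  proof -
    have "{{i, Suc i mod r} | i. i < r} = (\<lambda>i. {i, Suc i mod r}) ` {..<r}" by auto
    then show ?thesis unfolding E by (simp add: image_image)
  qed
  ultimately show thesis using that[of h] by (simp add: enumerates_cycle_def)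
qed

lemma enumerates_cycle_vertex:
  assumes "enumerates_cycle h r C" "v \<in> verts C"
  obtains i where "i < r" "h i = v"
proof -
  have "v \<in> h ` {..<r}" using assms by (auto simp: enumerates_cycle_def bij_betw_def)
  then show thesis using that by auto
qed

text \<open>
  Rotate the enumeration to start at \<open>a\<close>, and reverse it if \<open>b\<close> lies in its second half.
\<close>
lemma cycle_enumeration_between:
  assumes C: "is_cycle r C" and ab: "a \<in> verts C" "b \<in> verts C" "a \<noteq> b"
  obtains h d where "enumerates_cycle h r C" "h 0 = a" "h d = b" "0 < d" "2 * d \<le> r"
proof -
  obtain h0 where h0: "enumerates_cycle h0 r C" by (rule is_cycle_enumerates[OF C])
  then obtain p where p: "p < r" "h0 p = a" using ab(1) by (rule enumerates_cycle_vertex)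
  define h where "h = (\<lambda>i. h0 ((p + i) mod r))"
  have h: "enumerates_cycle h r C"
    unfolding h_def by (rule enumerates_cycle_rotate[OF h0 p(1)])
  have h_0: "h 0 = a" using p by (simp add: h_def)
  obtain d where d: "d < r" "h d = b" using h ab(2) by (rule enumerates_cycle_vertex)
  have "0 < d" using d h_0 ab(3) by (auto intro: Nat.gr0I)
  show thesis
  proof (cases "2 * d \<le> r")
    case True
    then show thesis using that h h_0 d \<open>0 < d\<close> by blast
  next
    case False
    show thesis
    proof (rule that[OF enumerates_cycle_reverse[OF h], of "r - d"])
      show "h ((r - 0) mod r) = a" using h_0 by simp
      show "h ((r - (r - d)) mod r) = b" using d by simp
    qed (use False d in auto)
  qed
qed

text \<open>
  The list \<open>L\<close> read cyclically is an \<open>\<alpha>\<close>-labelling of the cycle of length \<open>length L\<close>: the list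
  \<open>zip L (rotate1 L)\<close> consists of the pairs of labels at the ends of the edges.
\<close>
definition alpha_cyclic_word :: "nat \<Rightarrow> nat list \<Rightarrow> bool" where
  "alpha_cyclic_word t L \<longleftrightarrow>
     distinct L \<and> (\<forall>x\<in>set L. x \<le> length L) \<and>
     (\<forall>(x, y)\<in>set (zip L (rotate1 L)). x \<le> t \<longleftrightarrow> t < y) \<and>
     set (map (\<lambda>(x, y). (x - y) + (y - x)) (zip L (rotate1 L))) = {1..length L}"

lemma cycle_alpha_labelling:
  assumes h: "enumerates_cycle h r C" and L: "alpha_cyclic_word t L" "length L = r"
  obtains f where "alpha_labelling C t f" "\<And>i. i < r \<Longrightarrow> f (h i) = L ! i"
proof -
  define f where "f = (\<lambda>v. L ! inv_into {..<r} h v)"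
  let ?E = "\<lambda>i. {h i, h (Suc i mod r)}"
  have bij: "bij_betw h {..<r} (verts C)" and E: "edges C = ?E ` {..<r}"
    using h by (simp_all add: enumerates_cycle_def)
  have fh: "f (h i) = L ! i" if "i < r" for i
    using bij that by (simp add: f_def bij_betw_def)
  have zip: "set (zip L (rotate1 L)) = (\<lambda>i. (L ! i, L ! (Suc i mod r))) ` {..<r}"
    by (auto simp: set_zip nth_rotate1 L(2) intro!: exI)
  have weights: "spread f ` edges C = {1..r}"
  proof -
    have "spread f (?E i) = (L ! i - L ! (Suc i mod r)) + (L ! (Suc i mod r) - L ! i)"
      if "i < r" for i using that by (simp add: spread_doubleton fh)
    then have "spread f ` edges C =
        (\<lambda>(x, y). (x - y) + (y - x)) ` set (zip L (rotate1 L))"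
      unfolding E zip by (simp add: image_image)
    then show ?thesis using L by (simp add: alpha_cyclic_word_def)
  qed
  have card: "card (edges C) = r"
  proof (rule antisym)
    show "card (edges C) \<le> r" unfolding E using card_image_le[of "{..<r}" ?E] by simp
    \<comment> \<open>The \<open>r\<close> different weights need \<open>r\<close> different edges.\<close>
    show "r \<le> card (edges C)"
      using card_image_le[of "edges C" "spread f"] weights by (simp add: E)
  qed
  have "f ` verts C = set L"
  proof -
    have "f ` verts C = (\<lambda>i. L ! i) ` {..<r}"
      using fh by (simp add: image_image flip: bij_betw_imp_surj_on[OF bij])
    then show ?thesis using nth_image[of r L] L(2) by (simp add: lessThan_atLeast0)
  qed
  then have "f ` verts C \<subseteq> {0..r}" using L by (auto simp: alpha_cyclic_word_def)
  moreover have "inj_on f (verts C)"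
  proof -
    have "inj_on (\<lambda>i. f (h i)) {..<r}"
      using L by (auto simp: inj_on_def fh alpha_cyclic_word_def nth_eq_iff_index_eq)
    then show ?thesis
      using bij comp_inj_on_iff[of h "{..<r}" f] by (simp add: bij_betw_def comp_def)
  qed
  moreover have "\<exists>u v. e = {u, v} \<and> f u \<le> t \<and> t < f v" if e: "e \<in> edges C" for e
  proof -
    obtain i where i: "i < r" "e = ?E i" using e E by auto
    then have "L ! i \<le> t \<longleftrightarrow> t < L ! (Suc i mod r)"
      using L unfolding alpha_cyclic_word_def zip by auto
    then have "f (h i) \<le> t \<longleftrightarrow> t < f (h (Suc i mod r))" using i by (simp add: fh)
    then show ?thesis unfolding i(2) by (metis insert_commute not_le)
  qed
  ultimately have "alpha_labelling C t f" using weights card by (auto simp: alpha_labelling_def)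
  then show thesis using fh by (rule that)
qed

text \<open>
  These labellings of the cycles of length \<open>4 * n\<close> were found by a computer search that assigned the
  weights to edges from the largest weight to the smallest.  In all of them \<open>n\<close> is the unused label.
  The word at place \<open>j\<close> has the labels \<open>2 * n + 1\<close> and \<open>2 * n\<close>, which are those next to the
  threshold, at distances \<open>2 * j + 1\<close> and \<open>2 * j + 2\<close> from the label 0.  Thus \<open>n\<close> words serve all
  the distances from 1 to \<open>2 * n\<close>.
\<close>
definition alpha_cyclic_words :: "nat \<Rightarrow> nat list list" where
  "alpha_cyclic_words n =
  (if n = 1 then
     [[0, 3, 2, 4]] else
   if n = 2 then
     [[0, 5, 4, 6, 3, 7, 1, 8],
      [0, 7, 1, 5, 4, 6, 3, 8]] else
   if n = 3 then
     [[0, 7, 6, 8, 5, 9, 4, 10, 2, 11, 1, 12],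
      [0, 12, 4, 7, 6, 8, 2, 9, 5, 10, 1, 11],
      [0, 11, 1, 10, 5, 7, 6, 9, 2, 8, 4, 12]] else
   if n = 4 then
     [[0, 9, 8, 10, 7, 11, 6, 12, 5, 13, 3, 14, 2, 15, 1, 16],
      [0, 16, 3, 9, 8, 10, 7, 11, 6, 14, 5, 12, 2, 13, 1, 15],
      [0, 15, 1, 13, 6, 9, 8, 10, 2, 12, 7, 11, 5, 14, 3, 16],
      [0, 16, 3, 11, 6, 10, 7, 9, 8, 14, 5, 12, 2, 13, 1, 15]] else
   if n = 5 then
     [[0, 11, 10, 12, 9, 13, 8, 14, 7, 15, 6, 16, 4, 17, 3, 18, 2, 19, 1, 20],
      [0, 20, 3, 11, 10, 12, 9, 13, 8, 14, 7, 16, 6, 18, 4, 15, 2, 17, 1, 19],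
      [0, 20, 3, 12, 9, 11, 10, 14, 7, 13, 8, 16, 6, 18, 4, 15, 2, 17, 1, 19],
      [0, 20, 3, 13, 8, 12, 9, 11, 10, 16, 7, 14, 6, 18, 4, 15, 2, 17, 1, 19],
      [0, 20, 3, 13, 9, 14, 7, 16, 8, 11, 10, 12, 6, 18, 4, 15, 2, 17, 1, 19]] else
   if n = 6 then
     [[0, 13, 12, 14, 11, 15, 10, 16, 9, 17, 8, 18, 7, 19, 5, 20, 4, 21, 3, 22, 2, 23, 1, 24],
      [0, 24, 3, 13, 12, 14, 11, 15, 10, 16, 9, 17, 8, 19, 7, 22, 5, 18, 4, 20, 2, 21, 1, 23],
      [0, 24, 3, 19, 10, 13, 12, 14, 8, 15, 11, 16, 4, 18, 5, 22, 7, 17, 9, 20, 2, 21, 1, 23],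
      [0, 24, 3, 19, 5, 22, 7, 13, 12, 14, 11, 15, 10, 18, 8, 17, 4, 16, 9, 20, 2, 21, 1, 23],
      [0, 23, 1, 21, 2, 20, 8, 16, 10, 13, 12, 14, 9, 18, 11, 15, 4, 17, 7, 22, 5, 19, 3, 24],
      [0, 23, 1, 21, 2, 20, 8, 15, 11, 16, 10, 13, 12, 14, 4, 17, 9, 18, 7, 22, 5, 19, 3, 24]] else [])"

lemma alpha_cyclic_words:
  assumes "n \<in> {1..6}" "j < n"
  shows "let L = alpha_cyclic_words n ! j in
    length L = 4 * n \<and> alpha_cyclic_word (2 * n) L \<and>
    L ! 0 = 0 \<and> L ! (2 * j + 1) = 2 * n + 1 \<and> L ! (2 * j + 2) = 2 * n"
proof -
  \<comment> \<open>Quantifiers over lists can be evaluated.\<close>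
  have "\<forall>n\<in>set [1..<7]. \<forall>j\<in>set [0..<n]. let L = alpha_cyclic_words n ! j in
    length L = 4 * n \<and> alpha_cyclic_word (2 * n) L \<and>
    L ! 0 = 0 \<and> L ! (2 * j + 1) = 2 * n + 1 \<and> L ! (2 * j + 2) = 2 * n"
    by code_simp
  then show ?thesis using assms by auto
qed

lemma cycle_alpha_labelling_between:
  assumes n: "1 \<le> n" "n \<le> 6" and C: "is_cycle (4 * n) C"
    and ab: "a \<in> verts C" "b \<in> verts C" "a \<noteq> b"
  shows "\<exists>t f. alpha_labelling C t f \<and> f a = 0 \<and> (f b = t \<or> f b = Suc t)"
proof -
  obtain h d where h: "enumerates_cycle h (4 * n) C" "h 0 = a" "h d = b"
    and d: "0 < d" "2 * d \<le> 4 * n"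
    by (rule cycle_enumeration_between[OF C ab])
  define j where "j = (d - 1) div 2"
  have j: "j < n" "d = 2 * j + 1 \<or> d = 2 * j + 2" using d by (auto simp: j_def)
  define L where "L = alpha_cyclic_words n ! j"
  have L: "length L = 4 * n" "alpha_cyclic_word (2 * n) L"
    "L ! 0 = 0" "L ! (2 * j + 1) = 2 * n + 1" "L ! (2 * j + 2) = 2 * n"
    using alpha_cyclic_words[of n j] n j(1) unfolding L_def Let_def by auto
  obtain f where f: "alpha_labelling C (2 * n) f" "\<And>i. i < 4 * n \<Longrightarrow> f (h i) = L ! i"
    using cycle_alpha_labelling[OF h(1) L(2,1)] by blast
  have "f a = 0" using f(2)[of 0] h(2) L(3) n by simp
  moreover have "f b = 2 * n \<or> f b = Suc (2 * n)"
    using f(2)[of d] h(3) L(4,5) j d by auto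
  ultimately show ?thesis using f(1) by blast
qed

section \<open>Cyclic snakes\<close>

theorem corollary2p2:
  fixes G :: "'a graph" and n k :: nat
  assumes "1 \<le> n" and "n \<le> 6" and "1 \<le> k"
    and "cyclic_snake k (4 * n) G"
  shows "graceful G"
proof -
  obtain K B c where K: "(0::nat) < K"
    and B: "\<And>i. i < K \<Longrightarrow> simple_graph (B i) \<and> is_cycle (4 * n) (B i)"
    and G: "graph_Union B {..<K} = G"
    and meet: "\<And>i. Suc i < K \<Longrightarrow> verts (B i) \<inter> verts (B (Suc i)) = {c i}"
      "\<And>i j. Suc i < j \<Longrightarrow> j < K \<Longrightarrow> verts (B i) \<inter> verts (B j) = {}"
      "\<And>i. Suc (Suc i) < K \<Longrightarrow> c (Suc i) \<noteq> c i"
    by (rule snake_blocks[OF assms(4)]) blast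
  have "\<exists>t f. alpha_labelling (graph_Union B {..<K}) t f"
  proof (rule alpha_labelling_chain[where c = c])
    fix i assume i: "i < K"
    show "simple_graph (B i)" using B[OF i] by blast
    obtain h where "enumerates_cycle h (4 * n) (B i)"
      using B[OF i] is_cycle_enumerates by blast
    then show "edges (B i) \<noteq> {}" using \<open>1 \<le> n\<close> by (auto simp: enumerates_cycle_def lessThan_empty_iff)
    fix a b assume "a \<in> verts (B i)" "b \<in> verts (B i)" "a \<noteq> b"
    with B[OF i] assms(1,2)
    show "\<exists>t f. alpha_labelling (B i) t f \<and> f a = 0 \<and> (f b = t \<or> f b = Suc t)"
      by (intro cycle_alpha_labelling_between) auto
  qed (use meet K in auto)
  then show ?thesis using alpha_labelling_graceful G by blast
qed

end
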